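(* For any integer $k\geq 1$, there exists no simple graph $G$ such that $\mathrm{Jac}(G)\cong (\mathbb{Z}/2\mathbb{Z})^k$ as groups.
   Context: A graph is a finite connected graph, possibly with multiple edges, but without loops; a simple graph is a graph without multiple edges. A divisor on $G$ is a formal integral combination $D=\sum_{v\in V(G)} D(v)v$, of degree $\sum_v D(v)$. For $f: V(G)\to\mathbb{Z}$ put $\mathrm{div}(f)=\sum_{v}\big(\sum_{e=vw}(f(v)-f(w))\big)v$, the inner sum being over edges $e$ containing $v$ (counted with multiplicity). The Jacobian $\mathrm{Jac}(G)$ is the (finite) group of degree-zero divisors modulo the subgroup of divisors of the form $\mathrm{div}(f)$. *)

theory Defs
  imports "HOL-Algebra.Algebra"
begin

text \<open>
  A multigraph keeps its edges as named objects, each with a two-element set of endpoints. Hence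
  loops cannot occur, while distinct edges may have the same endpoints.
\<close>

record ('v, 'e) multigraph =
  verts :: "'v set"
  edges :: "'e set"
  ends :: "'e \<Rightarrow> 'v set"

definition adjacency :: "('v, 'e) multigraph \<Rightarrow> ('v \<times> 'v) set" where
  "adjacency G = {(v, w). \<exists>e \<in> edges G. ends G e = {v, w}}"

definition finite_connected_graph :: "('v, 'e) multigraph \<Rightarrow> bool" where
  "finite_connected_graph G \<longleftrightarrow>
     finite (verts G) \<and> verts G \<noteq> {} \<and> finite (edges G) \<and>
     (\<forall>e \<in> edges G. ends G e \<subseteq> verts G \<and> card (ends G e) = 2) \<and>
     (\<forall>v \<in> verts G. \<forall>w \<in> verts G. (v, w) \<in> (adjacency G)\<^sup>*)"

definition simple_graph :: "('v, 'e) multigraph \<Rightarrow> bool" where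
  "simple_graph G \<longleftrightarrow> finite_connected_graph G \<and> inj_on (ends G) (edges G)"

abbreviation divisor_group :: "('v, 'e) multigraph \<Rightarrow> ('v \<Rightarrow>\<^sub>0 int) monoid" where
  "divisor_group G \<equiv> free_Abelian_group (verts G)"

definition divisor_degree :: "('v, 'e) multigraph \<Rightarrow> ('v \<Rightarrow>\<^sub>0 int) \<Rightarrow> int" where
  "divisor_degree G D = (\<Sum>v \<in> verts G. Poly_Mapping.lookup D v)"

definition degree_zero_group :: "('v, 'e) multigraph \<Rightarrow> ('v \<Rightarrow>\<^sub>0 int) monoid" where
  "degree_zero_group G =
     (divisor_group G)\<lparr>carrier := {D \<in> carrier (divisor_group G). divisor_degree G D = 0}\<rparr>"

text \<open>
  The innermost sum has a single term: \<open>ends G e - {v}\<close> consists of the endpoint of \<open>e\<close>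
  other than \<open>v\<close>. Values of \<open>f\<close> outside \<open>verts G\<close> play no role.
\<close>

definition div_fun :: "('v, 'e) multigraph \<Rightarrow> ('v \<Rightarrow> int) \<Rightarrow> ('v \<Rightarrow>\<^sub>0 int)" where
  "div_fun G f =
     (\<Sum>v \<in> verts G.
        frag_cmul (\<Sum>e \<in> {e \<in> edges G. v \<in> ends G e}. \<Sum>w \<in> ends G e - {v}. f v - f w) (frag_of v))"

definition principal_divisors :: "('v, 'e) multigraph \<Rightarrow> ('v \<Rightarrow>\<^sub>0 int) set" where
  "principal_divisors G = range (div_fun G)"

definition Jac :: "('v, 'e) multigraph \<Rightarrow> ('v \<Rightarrow>\<^sub>0 int) set monoid" where
  "Jac G = degree_zero_group G Mod principal_divisors G"

lemma lookup_div_fun: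
  assumes "finite (verts G)"
  shows "Poly_Mapping.lookup (div_fun G f) v =
    (if v \<in> verts G
     then \<Sum>e \<in> {e \<in> edges G. v \<in> ends G e}. \<Sum>w \<in> ends G e - {v}. f v - f w else 0)"
  using assms by (simp add: div_fun_def lookup_sum if_distrib[of "\<lambda>x. _ * x"] cong: if_cong)

lemma divisor_degree_div_fun:
  assumes G: "finite_connected_graph G"
  shows "divisor_degree G (div_fun G f) = 0"
proof -
  have fin: "finite (verts G)" "finite (edges G)"
    using G by (auto simp: finite_connected_graph_def)
  have "divisor_degree G (div_fun G f) =
      (\<Sum>v\<in>verts G. \<Sum>e \<in> {e \<in> edges G. v \<in> ends G e}. \<Sum>w \<in> ends G e - {v}. f v - f w)"
    using fin by (simp add: divisor_degree_def lookup_div_fun)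
  also have "\<dots> = (\<Sum>e\<in>edges G. \<Sum>v\<in>{v\<in>verts G. v \<in> ends G e}. \<Sum>w \<in> ends G e - {v}. f v - f w)"
    using fin by (rule sum.swap_restrict)
  also have "\<dots> = (\<Sum>e\<in>edges G. 0)"
  proof (rule sum.cong)
    fix e assume e: "e \<in> edges G"
    then obtain a b where ab: "ends G e = {a, b}" "a \<noteq> b" "a \<in> verts G" "b \<in> verts G"
      using G unfolding finite_connected_graph_def card_2_iff by (metis insert_subset)
    then have "{v\<in>verts G. v \<in> ends G e} = {a, b}" "{a, b} - {a} = {b}" "{a, b} - {b} = {a}"
      by auto
    with ab show "(\<Sum>v\<in>{v\<in>verts G. v \<in> ends G e}. \<Sum>w \<in> ends G e - {v}. f v - f w) = 0"
      by simp
  qed simp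
  finally show ?thesis by simp
qed

lemma comm_group_degree_zero_group: "comm_group (degree_zero_group G)"
proof -
  interpret D: comm_group "divisor_group G"
    by (rule abelian_free_Abelian_group)
  have "subgroup {D \<in> carrier (divisor_group G). divisor_degree G D = 0} (divisor_group G)"
  proof (rule D.subgroupI)
    have "0 \<in> {D \<in> carrier (divisor_group G). divisor_degree G D = 0}"
      by (simp add: divisor_degree_def)
    then show "{D \<in> carrier (divisor_group G). divisor_degree G D = 0} \<noteq> {}" by blast
  next
    fix a b
    assume "a \<in> {D \<in> carrier (divisor_group G). divisor_degree G D = 0}"
      and "b \<in> {D \<in> carrier (divisor_group G). divisor_degree G D = 0}"
    then show "a \<otimes>\<^bsub>divisor_group G\<^esub> b \<in> {D \<in> carrier (divisor_group G). divisor_degree G D = 0}"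
      using keys_add[of a b] by (auto simp: divisor_degree_def lookup_add sum.distrib)
  qed (auto simp: divisor_degree_def sum_negf)
  then have "group (degree_zero_group G)"
    unfolding degree_zero_group_def by (rule D.subgroup_imp_group)
  then show ?thesis
    by (rule group.group_comm_groupI) (simp add: degree_zero_group_def add.commute)
qed

lemma normal_principal_divisors:
  assumes G: "finite_connected_graph G"
  shows "principal_divisors G \<lhd> degree_zero_group G"
proof -
  interpret D: comm_group "degree_zero_group G"
    by (rule comm_group_degree_zero_group)
  have fin: "finite (verts G)"
    using G by (simp add: finite_connected_graph_def)
  have lookup_eq: "Poly_Mapping.lookup (div_fun G f) v = 0" if "v \<notin> verts G" for f v
    using fin that by (simp add: lookup_div_fun)
  have mem: "div_fun G f \<in> carrier (degree_zero_group G)" for f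
    using lookup_eq divisor_degree_div_fun[OF G]
    by (auto simp: degree_zero_group_def in_keys_iff)
  have add: "div_fun G f + div_fun G g = div_fun G (\<lambda>v. f v + g v)" for f g
    using fin
    by (auto intro!: poly_mapping_eqI simp: lookup_add lookup_div_fun algebra_simps
        simp flip: sum.distrib)
  have zero: "div_fun G (\<lambda>v. 0) = 0"
    using fin by (auto intro!: poly_mapping_eqI simp: lookup_div_fun)
  have inv: "inv\<^bsub>degree_zero_group G\<^esub> (div_fun G f) = div_fun G (\<lambda>v. - f v)" for f
    by (rule D.inv_equality)
      (use mem add[of "\<lambda>v. - f v" f] zero in \<open>auto simp: degree_zero_group_def\<close>)
  have "subgroup (principal_divisors G) (degree_zero_group G)"
    using mem inv add
    by (intro D.subgroupI) (auto simp: principal_divisors_def degree_zero_group_def)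
  then show ?thesis
    by (rule D.subgroup_imp_normal)
qed

end

theory Submission
  imports Defs
begin

text \<open>
  Suppose that \<open>Jac G\<close> has exponent 2. For an edge \<open>vw\<close> write \<open>2v - 2w = div f\<close> and put
  \<open>d = f v - f w\<close>. Pairing \<open>f\<close> with \<open>div f\<close> shows that the squared differences of \<open>f\<close> along all edges
  sum to \<open>2d\<close>; the edge \<open>vw\<close> alone contributes \<open>d\<^sup>2\<close>, so \<open>d\<close> is 0, 1 or 2. If \<open>d = 0\<close>, then
  \<open>div f = 0\<close>, which is absurd. If \<open>d = 1\<close>, exactly one other edge carries a nonzero difference, and
  \<open>div f\<close> at \<open>v\<close> and at \<open>w\<close> forces this edge to be parallel to \<open>vw\<close>. So in a simple graph
  \<open>d = 2\<close>, no other edge carries a difference, and halving \<open>f\<close> gives \<open>v - w = div (f div 2)\<close>. By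
  connectedness every divisor of degree zero is then principal, so that \<open>Jac G\<close> is trivial.
\<close>

section \<open>Endpoints of edges and the Dirichlet energy of a function\<close>

lemma finite_connected_graph_ends:
  assumes "finite_connected_graph G" "e \<in> edges G" "x \<in> ends G e"
  obtains y where "ends G e = {x, y}" "y \<noteq> x" "x \<in> verts G" "y \<in> verts G"
proof -
  have "card (ends G e) = 2" "ends G e \<subseteq> verts G"
    using assms by (auto simp: finite_connected_graph_def)
  then show thesis
    using assms(3) that unfolding card_2_iff by (metis doubleton_eq_iff insert_iff insert_subset singletonD)
qed

text \<open>On an edge of a graph this is the squared difference of \<open>f\<close> along
  \<open>e\<close>. Summing over both endpoints avoids choosing an orientation and matches the terms
  of \<open>div_fun\<close> weighted by \<open>f x\<close>.\<close>

definition edge_energy :: "('v, 'e) multigraph \<Rightarrow> ('v \<Rightarrow> int) \<Rightarrow> 'e \<Rightarrow> int" where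
  "edge_energy G f e = (\<Sum>x \<in> ends G e. \<Sum>y \<in> ends G e - {x}. f x * (f x - f y))"

lemma edge_energy_eq:
  assumes "ends G e = {a, b}" "a \<noteq> b"
  shows "edge_energy G f e = (f a - f b)\<^sup>2"
proof -
  have "{a, b} - {a} = {b}" "{a, b} - {b} = {a}"
    using assms by auto
  then show ?thesis
    using assms by (simp add: edge_energy_def power2_eq_square algebra_simps)
qed

text \<open>The inner sum has one term, the contribution of \<open>e\<close> to the divisor of
  \<open>f\<close> at \<open>x\<close>. This translates bounds on energy into bounds on that
  contribution.\<close>

lemma edge_energy_eq_flow:
  assumes "finite_connected_graph G" "e \<in> edges G" "x \<in> ends G e"
  shows "edge_energy G f e = (\<Sum>y \<in> ends G e - {x}. f x - f y)\<^sup>2"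
proof -
  obtain y where y: "ends G e = {x, y}" "y \<noteq> x"
    using finite_connected_graph_ends[OF assms] .
  then have "ends G e - {x} = {y}" by auto
  then show ?thesis
    using y edge_energy_eq[of G e x y f] by simp
qed

lemma edge_energy_nonneg:
  assumes "finite_connected_graph G" "e \<in> edges G"
  shows "edge_energy G f e \<ge> 0"
proof -
  have "ends G e \<noteq> {}"
    using assms by (force simp: finite_connected_graph_def)
  then show ?thesis
    using edge_energy_eq_flow[OF assms] by auto
qed

text \<open>Summation by parts: after exchanging the sums over vertices and edges, each edge
  collects exactly the terms of its two endpoints.\<close>

lemma sum_edge_energy:
  assumes G: "finite_connected_graph G"
  shows "(\<Sum>e \<in> edges G. edge_energy G f e) =
    (\<Sum>x \<in> verts G. f x * Poly_Mapping.lookup (div_fun G f) x)"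
proof -
  have fin: "finite (verts G)" "finite (edges G)"
    using G by (auto simp: finite_connected_graph_def)
  have "(\<Sum>x \<in> verts G. f x * Poly_Mapping.lookup (div_fun G f) x) =
      (\<Sum>x\<in>verts G. \<Sum>e \<in> {e \<in> edges G. x \<in> ends G e}. \<Sum>y \<in> ends G e - {x}. f x * (f x - f y))"
    using fin by (simp add: lookup_div_fun sum_distrib_left)
  also have "\<dots> = (\<Sum>e\<in>edges G. \<Sum>x\<in>{x\<in>verts G. x \<in> ends G e}.
      \<Sum>y \<in> ends G e - {x}. f x * (f x - f y))"
    using fin by (rule sum.swap_restrict)
  also have "\<dots> = (\<Sum>e \<in> edges G. edge_energy G f e)"
  proof (rule sum.cong)
    fix e assume "e \<in> edges G"
    then have "{x\<in>verts G. x \<in> ends G e} = ends G e"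
      using G by (auto simp: finite_connected_graph_def)
    then show "(\<Sum>x\<in>{x\<in>verts G. x \<in> ends G e}. \<Sum>y \<in> ends G e - {x}. f x * (f x - f y)) =
        edge_energy G f e"
      by (simp add: edge_energy_def)
  qed simp
  finally show ?thesis by simp
qed

section \<open>Halving a function whose divisor is twice an edge difference\<close>

lemma principal_edge_if_double_principal:
  assumes simple: "simple_graph G"
    and e: "e \<in> edges G" "ends G e = {v, w}"
    and f: "div_fun G f = frag_cmul 2 (frag_of v - frag_of w)"
  shows "frag_of v - frag_of w \<in> principal_divisors G"
proof -
  have G: "finite_connected_graph G" and inj: "inj_on (ends G) (edges G)"
    using simple by (auto simp: simple_graph_def)
  have fin: "finite (verts G)" "finite (edges G)"
    using G by (auto simp: finite_connected_graph_def)
  have vw: "v \<noteq> w" "v \<in> verts G" "w \<in> verts G"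
    using e G by (force simp: finite_connected_graph_def)+
  define d where "d = f v - f w"
  have lookup: "Poly_Mapping.lookup (div_fun G f) x =
      2 * (if x = v then 1 else 0) - 2 * (if x = w then 1 else 0)" for x
    by (simp add: f lookup_minus)
  have "(\<Sum>e \<in> edges G. edge_energy G f e) =
      (\<Sum>x \<in> verts G. (if x = v then 2 * f v else 0) - (if x = w then 2 * f w else 0))"
    unfolding sum_edge_energy[OF G] lookup by (rule sum.cong) auto
  also have "\<dots> = 2 * d"
    using fin vw by (simp add: sum_subtractf d_def)
  finally have total: "(\<Sum>e \<in> edges G. edge_energy G f e) = 2 * d" .
  have energy_e: "edge_energy G f e = d\<^sup>2"
    using edge_energy_eq[OF e(2) vw(1)] by (simp add: d_def)
  \<comment> \<open>Energies are nonnegative, so \<open>2 * d\<close> is a budget for every set of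
    edges; all three cases below exploit it.\<close>
  have le_total: "sum (edge_energy G f) A \<le> 2 * d" if "A \<subseteq> edges G" for A
    using sum_mono2[OF fin(2) that, of "edge_energy G f"] edge_energy_nonneg[OF G] total by auto
  have "d\<^sup>2 \<le> 2 * d"
    using le_total[of "{e}"] e energy_e by simp
  then have "0 \<le> d"
    using zero_le_power2[of d] by linarith
  moreover have "d \<le> 2"
  proof (rule ccontr)
    assume "\<not> d \<le> 2"
    then have "2 * d < d * d" by simp
    with \<open>d\<^sup>2 \<le> 2 * d\<close> show False by (simp add: power2_eq_square)
  qed
  ultimately consider "d = 0" | "d = 1" | "d = 2"
    by linarith
  then show ?thesis
  proof cases
    case 1
    \<comment> \<open>The budget is 0, so no edge contributes to the divisor at \<open>v\<close>,
      where the coefficient should be 2.\<close>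
    have "(\<Sum>y \<in> ends G e' - {v}. f v - f y) = 0" if "e' \<in> edges G" "v \<in> ends G e'" for e'
    proof -
      have "edge_energy G f e' = 0"
        using le_total[of "{e'}"] edge_energy_nonneg[OF G that(1), of f] that 1 by simp
      then show ?thesis
        using edge_energy_eq_flow[OF G that, of f] by simp
    qed
    then have "Poly_Mapping.lookup (div_fun G f) v = 0"
      using vw fin by (simp add: lookup_div_fun)
    then show ?thesis
      using lookup[of v] vw by simp
  next
    case 2
    \<comment> \<open>The coefficient at \<open>x\<close> is 2 or -2, but \<open>e\<close>
      contributes only 1 or -1 there. Hence another edge at \<open>x\<close> has a nonzero
      difference, and by integrality its energy is at least 1.\<close>
    have other: "\<exists>e' \<in> edges G. e' \<noteq> e \<and> x \<in> ends G e' \<and> edge_energy G f e' \<ge> 1"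
      if x: "x \<in> {v, w}" for x
    proof (rule ccontr)
      assume none: "\<not> ?thesis"
      let ?flow = "\<lambda>e'. \<Sum>y \<in> ends G e' - {x}. f x - f y"
      have zero: "?flow e' = 0" if "e' \<in> edges G" "e' \<noteq> e" "x \<in> ends G e'" for e'
      proof -
        have "edge_energy G f e' = 0"
          using none that edge_energy_nonneg[OF G that(1), of f] by force
        then show ?thesis
          using edge_energy_eq_flow[OF G that(1,3), of f] by simp
      qed
      have "Poly_Mapping.lookup (div_fun G f) x = sum ?flow {e \<in> edges G. x \<in> ends G e}"
        using x vw fin by (auto simp: lookup_div_fun)
      also have "\<dots> = sum ?flow {e}"
        using fin e x zero by (intro sum.mono_neutral_right) auto
      finally have "\<bar>?flow e\<bar> = 2"
        using lookup[of x] x vw by auto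
      then have "(?flow e)\<^sup>2 = 2\<^sup>2"
        by (metis power2_abs)
      then show False
        using edge_energy_eq_flow[OF G e(1), of x f] energy_e x e 2 by auto
    qed
    obtain e1 where e1: "e1 \<in> edges G" "e1 \<noteq> e" "v \<in> ends G e1" "edge_energy G f e1 \<ge> 1"
      using other[of v] by auto
    obtain e2 where e2: "e2 \<in> edges G" "e2 \<noteq> e" "w \<in> ends G e2" "edge_energy G f e2 \<ge> 1"
      using other[of w] by auto
    \<comment> \<open>Three distinct edges of energy at least 1 would exceed the budget of
      2.\<close>
    have "e1 = e2"
    proof (rule ccontr)
      assume "e1 \<noteq> e2"
      then show False
        using le_total[of "{e, e1, e2}"] e1 e2 e energy_e 2 by simp
    qed
    \<comment> \<open>The common edge contains both \<open>v\<close> and \<open>w\<close>, hence is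
      parallel to \<open>e\<close>, which simplicity excludes.\<close>
    then have "ends G e1 = ends G e"
      using finite_connected_graph_ends[OF G e1(1,3)] e2(3) e(2) vw(1)
      by (metis empty_iff insert_iff)
    then have "e1 = e"
      using inj e1 e by (simp add: inj_on_def)
    with e1 show ?thesis by simp
  next
    case 3
    \<comment> \<open>The edge \<open>e\<close> alone uses up the whole budget of 4.\<close>
    have eq: "f a = f b" if "e' \<in> edges G" "e' \<noteq> e" "ends G e' = {a, b}" "a \<noteq> b" for a b e'
      using le_total[of "{e, e'}"] that e energy_e 3 edge_energy_eq[OF that(3,4), of f]
      by simp
    \<comment> \<open>Rounding is harmless whatever the parity of \<open>f\<close>: only differences
      along edges matter. Along \<open>e\<close> the values of \<open>f\<close> differ by 2, so
      those of \<open>g\<close> differ by 1; along any other edge \<open>f\<close>, and so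
      \<open>g\<close>, does not change.\<close>
    define g where "g x = f x div 2" for x
    have g: "2 * (\<Sum>y \<in> ends G e' - {x}. g x - g y) = (\<Sum>y \<in> ends G e' - {x}. f x - f y)"
      if e': "e' \<in> edges G" "x \<in> ends G e'" for e' x
    proof -
      obtain y where y: "ends G e' = {x, y}" "y \<noteq> x"
        using finite_connected_graph_ends[OF G e'] .
      then have "ends G e' - {x} = {y}" by auto
      moreover have "2 * (g x - g y) = f x - f y"
      proof (cases "e' = e")
        case True
        have "f v = f w + 2"
          using 3 by (simp add: d_def)
        then have "g v = g w + 1"
          by (simp add: g_def)
        with True \<open>f v = f w + 2\<close> y e show ?thesis
          by (auto simp: doubleton_eq_iff)
      next
        case False
        then show ?thesis
          using eq[OF e'(1) False y(1)] y by (simp add: g_def)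
      qed
      ultimately show ?thesis by simp
    qed
    have "frag_of v - frag_of w = div_fun G g"
    proof (rule poly_mapping_eqI)
      fix x
      have "2 * Poly_Mapping.lookup (div_fun G g) x = Poly_Mapping.lookup (div_fun G f) x"
        using fin g by (simp add: lookup_div_fun sum_distrib_left)
      then show "Poly_Mapping.lookup (frag_of v - frag_of w) x = Poly_Mapping.lookup (div_fun G g) x"
        unfolding lookup by (simp add: lookup_minus)
    qed
    then show ?thesis
      by (simp add: principal_divisors_def)
  qed
qed

section \<open>Edge differences generate the divisors of degree zero\<close>

lemma div_fun_sum:
  assumes "finite (verts G)" "finite A"
  shows "div_fun G (\<lambda>x. \<Sum>u\<in>A. c u * F u x) = (\<Sum>u\<in>A. frag_cmul (c u) (div_fun G (F u)))"
    (is "?l = ?r")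
proof (rule poly_mapping_eqI)
  fix v
  let ?E = "{e \<in> edges G. v \<in> ends G e}"
  have "(\<Sum>e\<in>?E. \<Sum>w\<in>ends G e - {v}. (\<Sum>u\<in>A. c u * F u v) - (\<Sum>u\<in>A. c u * F u w)) =
      (\<Sum>e\<in>?E. \<Sum>w\<in>ends G e - {v}. \<Sum>u\<in>A. c u * (F u v - F u w))"
    by (simp add: right_diff_distrib sum_subtractf)
  also have "\<dots> = (\<Sum>e\<in>?E. \<Sum>u\<in>A. \<Sum>w\<in>ends G e - {v}. c u * (F u v - F u w))"
    by (intro sum.cong refl sum.swap)
  also have "\<dots> = (\<Sum>u\<in>A. c u * (\<Sum>e\<in>?E. \<Sum>w\<in>ends G e - {v}. F u v - F u w))"
    by (subst sum.swap) (simp add: sum_distrib_left)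
  finally show "Poly_Mapping.lookup ?l v = Poly_Mapping.lookup ?r v"
    using assms by (simp add: lookup_sum lookup_div_fun)
qed

lemma principal_divisors_add:
  assumes fin: "finite (verts G)"
    and "D \<in> principal_divisors G" "D' \<in> principal_divisors G"
  shows "D + D' \<in> principal_divisors G"
proof -
  obtain f g where "D = div_fun G f" "D' = div_fun G g"
    using assms by (auto simp: principal_divisors_def)
  then have "D + D' = div_fun G (\<lambda>x. f x + g x)"
    \<comment> \<open>A sum of two is linearity over the index set \<open>bool\<close>, with both
      coefficients 1.\<close>
    using div_fun_sum[OF fin, of "UNIV :: bool set" "\<lambda>_. 1" "\<lambda>b. if b then f else g"]
    by (simp add: UNIV_bool add.commute)
  then show ?thesis
    by (simp add: principal_divisors_def)
qed

text \<open>Edge differences telescope along paths from a root \<open>r\<close>, and the differences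
  with \<open>r\<close> generate: in the sum of all \<open>D(v) (v - r)\<close> the terms in
  \<open>r\<close> cancel because the degree of \<open>D\<close> is zero.\<close>

lemma degree_zero_principal:
  assumes G: "finite_connected_graph G"
    and edge: "\<And>e v w. e \<in> edges G \<Longrightarrow> ends G e = {v, w} \<Longrightarrow>
      frag_of v - frag_of w \<in> principal_divisors G"
    and D: "D \<in> carrier (degree_zero_group G)"
  shows "D \<in> principal_divisors G"
proof -
  have fin: "finite (verts G)"
    using G by (simp add: finite_connected_graph_def)
  obtain r where r: "r \<in> verts G"
    using G by (auto simp: finite_connected_graph_def)
  have path: "frag_of r - frag_of v \<in> principal_divisors G" if "(r, v) \<in> (adjacency G)\<^sup>*" for v
    using that
  proof (induction rule: rtrancl_induct)
    case base
    have "div_fun G (\<lambda>_. 0) = 0"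
      using fin by (auto intro!: poly_mapping_eqI simp: lookup_div_fun)
    then show ?case
      by (auto simp: principal_divisors_def intro: range_eqI[of _ _ "\<lambda>_. 0"])
  next
    case (step y z)
    then have "frag_of y - frag_of z \<in> principal_divisors G"
      using edge by (auto simp: adjacency_def)
    with step.IH show ?case
      using principal_divisors_add[OF fin] by fastforce
  qed
  have "\<exists>f. frag_of r - frag_of v = div_fun G f" if "v \<in> verts G" for v
    using path[of v] that r G by (auto simp: finite_connected_graph_def principal_divisors_def)
  then obtain F where F: "frag_of r - frag_of v = div_fun G (F v)" if "v \<in> verts G" for v
    by metis
  \<comment> \<open>The sign is negative because \<open>F v\<close> yields \<open>r - v\<close>
    rather than \<open>v - r\<close>.\<close>
  define c where "c v = - Poly_Mapping.lookup D v" for v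
  have D': "Poly_Mapping.lookup D v = 0" if "v \<notin> verts G" for v
    using D that by (auto simp: degree_zero_group_def in_keys_iff)
  have deg: "(\<Sum>v\<in>verts G. Poly_Mapping.lookup D v) = 0"
    using D by (simp add: degree_zero_group_def divisor_degree_def)
  have "div_fun G (\<lambda>x. \<Sum>u\<in>verts G. c u * F u x) =
      (\<Sum>u\<in>verts G. frag_cmul (c u) (frag_of r - frag_of u))"
    by (simp add: div_fun_sum[OF fin fin] F)
  also have "\<dots> = D"
  proof (rule poly_mapping_eqI)
    fix x
    have "Poly_Mapping.lookup (\<Sum>u\<in>verts G. frag_cmul (c u) (frag_of r - frag_of u)) x =
        (\<Sum>u\<in>verts G. c u * (if r = x then 1 else 0) - (if x = u then c u else 0))"
      unfolding lookup_sum by (rule sum.cong) (auto simp: lookup_minus right_diff_distrib)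
    also have "\<dots> = Poly_Mapping.lookup D x"
      using fin D' deg by (simp add: sum_subtractf sum_negf c_def flip: sum_distrib_right)
    finally show "Poly_Mapping.lookup (\<Sum>u\<in>verts G. frag_cmul (c u) (frag_of r - frag_of u)) x =
        Poly_Mapping.lookup D x" .
  qed
  finally show ?thesis
    by (metis principal_divisors_def rangeI)
qed

section \<open>A Jacobian of exponent 2 would be trivial\<close>

theorem theorem5:
  fixes k :: nat
  assumes "k \<ge> 1"
  shows "\<not> (\<exists>G :: ('v, 'e) multigraph.
    simple_graph G \<and> Jac G \<cong> product_group {..<k} (\<lambda>_. integer_mod_group 2))"
proof
  let ?H = "product_group {..<k} (\<lambda>_. integer_mod_group 2)"
  assume "\<exists>G :: ('v, 'e) multigraph. simple_graph G \<and> Jac G \<cong> ?H"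
  then obtain G :: "('v, 'e) multigraph" and h
    where simple: "simple_graph G" and h: "h \<in> iso (Jac G) ?H"
    by (auto simp: is_iso_def)
  have G: "finite_connected_graph G"
    using simple by (simp add: simple_graph_def)
  let ?P = "principal_divisors G"
  interpret P: normal ?P "degree_zero_group G"
    using normal_principal_divisors[OF G] .
  have group_J: "group (Jac G)"
    unfolding Jac_def by (rule P.factorgroup_is_group)
  have group_H: "group ?H"
    by simp
  have hom: "h \<in> hom (Jac G) ?H" and inj: "inj_on h (carrier (Jac G))"
    and surj: "h ` carrier (Jac G) = carrier ?H"
    using h by (auto simp: iso_def bij_betw_def)
  have sq_H: "x \<otimes>\<^bsub>?H\<^esub> x = \<one>\<^bsub>?H\<^esub>" if "x \<in> carrier ?H" for x
    using that by (force simp: integer_mod_group_def fun_eq_iff PiE_iff restrict_def)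
  have sq_J: "x \<otimes>\<^bsub>Jac G\<^esub> x = \<one>\<^bsub>Jac G\<^esub>" if "x \<in> carrier (Jac G)" for x
  proof -
    have "h x \<in> carrier ?H"
      using surj that by blast
    then have "h (x \<otimes>\<^bsub>Jac G\<^esub> x) = h \<one>\<^bsub>Jac G\<^esub>"
      using hom_mult[OF hom that that] sq_H hom_one[OF hom group_J group_H] by simp
    then show ?thesis
      using inj that group_J by (metis group.is_monoid inj_onD monoid.m_closed monoid.one_closed)
  qed
  \<comment> \<open>The square of the coset of \<open>D\<close> is the coset of
    \<open>D + D\<close>. It equals \<open>?P\<close> and contains \<open>D + D\<close>.\<close>
  have double: "D + D \<in> ?P" if D: "D \<in> carrier (degree_zero_group G)" for D
  proof -
    have "?P #>\<^bsub>degree_zero_group G\<^esub> D \<in> carrier (Jac G)"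
      using D by (auto simp: Jac_def FactGroup_def RCOSETS_def)
    from sq_J[OF this] have "?P #>\<^bsub>degree_zero_group G\<^esub> (D + D) = ?P"
      using P.rcos_sum[OF D D] by (simp add: Jac_def FactGroup_def degree_zero_group_def)
    moreover have "D + D \<in> carrier (degree_zero_group G)"
      using P.m_closed[OF D D] by (simp add: degree_zero_group_def)
    ultimately show ?thesis
      using P.rcos_self[OF _ P.is_subgroup] by blast
  qed
  have edge: "frag_of v - frag_of w \<in> ?P" if e: "e \<in> edges G" "ends G e = {v, w}" for e v w
  proof -
    have vw: "v \<in> verts G" "w \<in> verts G" and fin: "finite (verts G)"
      using e G by (force simp: finite_connected_graph_def)+
    have "frag_of v - frag_of w \<in> carrier (degree_zero_group G)"
      using vw fin keys_diff[of "frag_of v" "frag_of w"]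
      by (auto simp: degree_zero_group_def divisor_degree_def lookup_minus sum_subtractf)
    then have "frag_cmul 2 (frag_of v - frag_of w) \<in> ?P"
      using double frag_cmul_distrib[of 1 1 "frag_of v - frag_of w"] by simp
    then show ?thesis
      using principal_edge_if_double_principal[OF simple e] by (auto simp: principal_divisors_def)
  qed
  have "carrier (Jac G) \<subseteq> {?P}"
  proof
    fix x assume "x \<in> carrier (Jac G)"
    then obtain D where D: "D \<in> carrier (degree_zero_group G)"
      and x: "x = ?P #>\<^bsub>degree_zero_group G\<^esub> D"
      by (auto simp: Jac_def FactGroup_def RCOSETS_def)
    have "D \<in> ?P"
      by (rule degree_zero_principal[OF G _ D]) (rule edge)
    with D x show "x \<in> {?P}"
      using P.coset_join2[OF D P.is_subgroup] by simp
  qed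
  then have "carrier ?H \<subseteq> {h ?P}"
    using surj by auto
  \<comment> \<open>The constant tuples 0 and 1 show that the target group is nontrivial: they
    differ at coordinate 0, which lies in \<open>{..<k}\<close> as \<open>k\<close> is
    positive.\<close>
  moreover have "(\<lambda>i\<in>{..<k}. c) \<in> carrier ?H" if "c \<in> {0, 1}" for c :: int
    using that by (auto simp: integer_mod_group_def)
  ultimately have "(\<lambda>i\<in>{..<k}. 0 :: int) = (\<lambda>i\<in>{..<k}. 1)"
    by (metis (no_types) insertCI singletonD subsetD)
  from fun_cong[OF this, of 0] show False
    using assms by simp
qed

end
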